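(* Let $N>0$ be a fixed real number. For real coefficients $A,B,C,D,E$ with $D+E\neq 0$, consider the function of $x$ (for $x$ near $0$) $$s(x)=AN+B\frac{M}{N^3}+\frac{CNx}{DM+EN^4},\qquad M=N^4+x.$$ (i) The Maclaurin expansion of $s(x)$ in powers of $x$ coincides with that of $\sqrt[4]{N^4+x}$ for all powers up to and including $x^3$ if and only if $s$ is the function $$S(x)=\frac{51}{56}N+\frac{5}{56}\frac{M}{N^3}+\frac{27Nx}{14(7M+5N^4)}.$$ (ii) There is no choice of $A,B,C,D,E$ (with $D+E\ne 0$) for which the Maclaurin expansions of $s(x)$ and $\sqrt[4]{N^4+x}$ coincide for all powers up to and including $x^4$. Hence $S(x)$ is the best possible and unique approximation to $\sqrt[4]{N^4+x}$ of the given form.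
   Context: An approximation $s(x)$ of the given form is "best possible" (as accurate as possible) when its Maclaurin expansion in $x$ coincides with that of $\sqrt[4]{N^4+x}$ to as high a power of $x$ as possible. $\sqrt[4]{\cdot}$ denotes the positive real fourth root. Equality of $s$ and $S$ means equality as functions of $x$ near $0$ (the coefficients $C,D,E$ themselves are only determined up to a common nonzero factor). *)

theory Defs
  imports "HOL-Analysis.Analysis" "HOL-Computational_Algebra.Formal_Power_Series"
begin

definition maclaurin :: "(real \<Rightarrow> real) \<Rightarrow> real fps" where
  "maclaurin f = Abs_fps (\<lambda>k. (deriv ^^ k) f 0 / fact k)"

definition maclaurin_coincide :: "nat \<Rightarrow> (real \<Rightarrow> real) \<Rightarrow> (real \<Rightarrow> real) \<Rightarrow> bool" where
  "maclaurin_coincide n f g \<longleftrightarrow> (\<forall>k\<le>n. fps_nth (maclaurin f) k = fps_nth (maclaurin g) k)"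

definition equal_near_0 :: "(real \<Rightarrow> real) \<Rightarrow> (real \<Rightarrow> real) \<Rightarrow> bool" where
  "equal_near_0 f g \<longleftrightarrow> (\<forall>\<^sub>F x in nhds 0. f x = g x)"

definition fourth_root :: "real \<Rightarrow> real \<Rightarrow> real" where
  "fourth_root N x = root 4 (N ^ 4 + x)"

definition approx :: "real \<Rightarrow> real \<Rightarrow> real \<Rightarrow> real \<Rightarrow> real \<Rightarrow> real \<Rightarrow> real \<Rightarrow> real" where
  "approx N A B C D E x =
     (let M = N ^ 4 + x in A * N + B * (M / N ^ 3) + C * N * x / (D * M + E * N ^ 4))"

(* For N > 0 the condition D + E \<noteq> 0 says that the denominator D M + E N^4 is nonzero at x = 0,
   hence near 0. *)
definition approx_form :: "real \<Rightarrow> (real \<Rightarrow> real) set" where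
  "approx_form N = {approx N A B C D E | A B C D E. D + E \<noteq> 0}"

definition S_approx :: "real \<Rightarrow> real \<Rightarrow> real" where
  "S_approx N x =
     (let M = N ^ 4 + x in
        51 / 56 * N + 5 / 56 * (M / N ^ 3) + 27 * N * x / (14 * (7 * M + 5 * N ^ 4)))"

(* Coincidence to as high a power as possible: whenever some member of F coincides with f
   through x^n, so does s. *)
definition best_possible :: "(real \<Rightarrow> real) set \<Rightarrow> (real \<Rightarrow> real) \<Rightarrow> (real \<Rightarrow> real) \<Rightarrow> bool" where
  "best_possible F f s \<longleftrightarrow>
     s \<in> F \<and> (\<forall>n. \<forall>t\<in>F. maclaurin_coincide n t f \<longrightarrow> maclaurin_coincide n s f)"

end

(* Only c = C/(D + E) and d = D/(D + E) matter, and with r = d/N^4 the expansion of s is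
     (A + B) N + (B + c)/N^3 x + c/N^3 (-r) x^2 + c/N^3 (-r)^2 x^3 + c/N^3 (-r)^3 x^4 + ...
   Comparing with the binomial series of the fourth root, the coefficients of x^2 and x^3 give
   c d = 3/32 and c d^2 = 7/128, hence d = 7/12 and c = 9/56; then those of x and 1 give
   B = 5/56 and A = 51/56. The coefficient of x^4 would require c d^3 = 77/2048, but
   c d^3 = 49/1536. *)

theory Submission
  imports Defs
begin

text \<open>Termwise differentiation keeps an expansion valid, and the constant term of the k-th
  formal derivative is k! times the k-th coefficient. This trades iterated derivatives for power
  series algebra.\<close>

lemma maclaurin_eq_fps_expansion:
  assumes "f has_fps_expansion F"
  shows "maclaurin f = F"
proof (rule fps_ext)
  fix k
  have "(deriv ^^ k) f has_fps_expansion (fps_deriv ^^ k) F"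
    by (induction k) (use assms in \<open>auto intro: has_fps_expansion_deriv\<close>)
  \<comment> \<open>What holds eventually in \<open>nhds 0\<close> holds at the point 0
    itself.\<close>
  then have "(deriv ^^ k) f 0 = fps_nth ((fps_deriv ^^ k) F) 0"
    by (auto simp: has_fps_expansion_def eval_fps_at_0 dest: eventually_nhds_x_imp_x)
  also have "\<dots> = fact k * fps_nth F k"
    by (simp add: fps_0th_higher_deriv)
  finally show "fps_nth (maclaurin f) k = fps_nth F k"
    by (simp add: maclaurin_def)
qed

lemma maclaurin_cong:
  assumes "equal_near_0 f g"
  shows "maclaurin f = maclaurin g"
  using assms by (simp add: maclaurin_def equal_near_0_def higher_deriv_cong_ev)

text \<open>Geometric series: its product with 1 + rX telescopes to 1, and inverses are
  unique.\<close>

lemma fps_nth_inverse_one_plus_const_X: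
  fixes r :: "'a :: field"
  shows "fps_nth (inverse (1 + fps_const r * fps_X)) n = (- r) ^ n"
proof -
  have "inverse (1 + fps_const r * fps_X) = Abs_fps (\<lambda>n. (- r) ^ n)"
  proof (rule fps_inverse_unique, rule fps_ext)
    fix n
    show "fps_nth ((1 + fps_const r * fps_X) * Abs_fps (\<lambda>n. (- r) ^ n)) n = fps_nth 1 n"
      by (cases n) (simp_all add: distrib_right mult.assoc)
  qed
  then show ?thesis
    by simp
qed

text \<open>Newton's binomial series with exponent 1/4, convergent for |x| < N^4.\<close>

lemma maclaurin_fourth_root:
  assumes "N > 0"
  shows "fps_nth (maclaurin (fourth_root N)) k = ((1/4) gchoose k) * N / N ^ (4 * k)"
proof -
  have "(\<lambda>n. ((1/4) gchoose n) * N / N ^ (4 * n) * x ^ n) sums fourth_root N x"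
    if "\<bar>x\<bar> < N ^ 4" for x
  proof -
    have "root 4 (N ^ 4 + x) = (N ^ 4 + x) powr (1/4)"
      using that by (simp add: root_powr_inverse)
    moreover have "(N ^ 4) powr (1/4 - real n) = N / N ^ (4 * n)" for n
    proof -
      have "(N ^ 4) powr (1/4 - real n) = N powr (1 - real (4 * n))"
        using assms by (simp add: powr_powr right_diff_distrib flip: powr_numeral)
      also have "\<dots> = N / N ^ (4 * n)"
        using assms by (simp only: powr_diff powr_realpow powr_one)
      finally show ?thesis .
    qed
    ultimately show ?thesis
      using gen_binomial_real''[OF that, of "1/4"]
      by (simp add: fourth_root_def)
  qed
  moreover have "eventually (\<lambda>x::real. \<bar>x\<bar> < N ^ 4) (nhds 0)"
    using eventually_nhds_in_open[of "ball (0::real) (N ^ 4)" 0] assms by simp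
  ultimately have "fourth_root N has_fps_expansion Abs_fps (\<lambda>n. ((1/4) gchoose n) * N / N ^ (4 * n))"
    by (intro has_fps_expansionI) (auto elim: eventually_mono)
  then show ?thesis
    by (simp add: maclaurin_eq_fps_expansion)
qed

text \<open>Factoring (D + E) N^4 out of the denominator leaves only the ratios of C and D to D + E.
  The identity holds at a pole too, where both fractions take the default value 0, so it can serve
  as an equation between functions.\<close>

lemma approx_normal_form:
  assumes "N > 0" "D + E \<noteq> 0"
  shows "approx N A B C D E x =
    (A + B) * N + B / N ^ 3 * x
    + C / (D + E) / N ^ 3 * (x * inverse (1 + D / (D + E) / N ^ 4 * x))"
proof -
  have "D * (N ^ 4 + x) + E * N ^ 4 = (D + E) * N ^ 4 * (1 + D / (D + E) / N ^ 4 * x)"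
    using assms by (simp add: distrib_left) (simp add: algebra_simps)
  then show ?thesis
    using assms by (simp add: approx_def Let_def divide_simps)
      (simp add: algebra_simps eval_nat_numeral)
qed

text \<open>The factor x in front of the geometric series shifts it by one place, so the coefficient
  of x^(k+2) carries the power k + 1 of the ratio -d/N^4. The parameters A and B enter only the
  first two coefficients.\<close>

lemma maclaurin_approx:
  fixes C :: real
  assumes "N > 0" "D + E \<noteq> 0"
  defines "c \<equiv> C / (D + E)" and "d \<equiv> D / (D + E)"
  shows "fps_nth (maclaurin (approx N A B C D E)) 0 = (A + B) * N"
    and "fps_nth (maclaurin (approx N A B C D E)) (Suc 0) = (B + c) / N ^ 3"
    and "fps_nth (maclaurin (approx N A B C D E)) (Suc (Suc k)) = c / N ^ 3 * (- d / N ^ 4) ^ Suc k"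
proof -
  have "approx N A B C D E has_fps_expansion
     fps_const ((A + B) * N) + fps_const (B / N ^ 3) * fps_X
     + fps_const (c / N ^ 3) * (fps_X * inverse (1 + fps_const (d / N ^ 4) * fps_X))"
    unfolding approx_normal_form[OF assms(1,2), abs_def] c_def d_def
    by (intro fps_expansion_intros) auto
  note maclaurin_eq_fps_expansion[OF this, simp]
  show "fps_nth (maclaurin (approx N A B C D E)) 0 = (A + B) * N"
    and "fps_nth (maclaurin (approx N A B C D E)) (Suc 0) = (B + c) / N ^ 3"
    and "fps_nth (maclaurin (approx N A B C D E)) (Suc (Suc k)) = c / N ^ 3 * (- d / N ^ 4) ^ Suc k"
    by (simp_all add: fps_nth_inverse_one_plus_const_X add_divide_distrib)
qed

text \<open>Substituting c d = 3/32 into (c d) d = 7/128 makes the system linear in d.\<close>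

lemma coeff_match_unique:
  fixes c d :: real
  assumes "c * d = 3/32" "c * d\<^sup>2 = 7/128"
  shows "d = 7/12" "c = 9/56"
proof -
  have "c * d * d = 7/128"
    using assms(2) by (simp add: power2_eq_square)
  then show "d = 7/12"
    unfolding assms(1) by simp
  with assms(1) show "c = 9/56"
    by simp
qed

text \<open>Both sides carry the common factor 1/(N^3 (N^4)^k); cancelling it turns the matching of
  coefficients into a condition free of N.\<close>

lemma coeff_eq_iff:
  fixes N :: real
  assumes "N > 0"
  shows "c / N ^ 3 * (- d / N ^ 4) ^ k = p * N / N ^ (4 * Suc k) \<longleftrightarrow> c * (- d) ^ k = p"
proof -
  have "N ^ (4 * Suc k) = N * N ^ 3 * (N ^ 4) ^ k"
    unfolding mult_Suc_right power_add power_mult by (simp add: power4_eq_xxxx power3_eq_cube)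
  then show ?thesis
    unfolding power_divide using assms by simp
qed

lemma gbinomial_one_quarter:
  "((1/4 :: real) gchoose Suc 0) = 1/4"
  "((1/4 :: real) gchoose Suc (Suc 0)) = - 3/32"
  "((1/4 :: real) gchoose Suc (Suc (Suc 0))) = 7/128"
  "((1/4 :: real) gchoose Suc (Suc (Suc (Suc 0)))) = - 77/2048"
  by (simp_all add: gbinomial_Suc atLeast0_atMost_Suc)

lemma coincide_3_iff_coeffs:
  assumes "N > 0" "D + E \<noteq> 0"
  shows "maclaurin_coincide 3 (approx N A B C D E) (fourth_root N) \<longleftrightarrow>
    A = 51/56 \<and> B = 5/56 \<and> C / (D + E) = 9/56 \<and> D / (D + E) = 7/12"
proof -
  define c d where "c = C / (D + E)" and "d = D / (D + E)"
  note nths = maclaurin_approx[OF assms, of A B C, folded c_def d_def]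
    maclaurin_fourth_root[OF assms(1)]
  have all_le_3: "(\<forall>k\<le>3. P k) \<longleftrightarrow> P 0 \<and> P (Suc 0) \<and> P (Suc (Suc 0)) \<and> P (Suc (Suc (Suc 0)))" for P
    by (auto simp: numeral_eq_Suc le_Suc_eq)
  have "(A + B) * N = ((1/4) gchoose 0) * N / N ^ (4 * 0) \<longleftrightarrow> A + B = 1"
    "(B + c) / N ^ 3 = ((1/4) gchoose Suc 0) * N / N ^ (4 * Suc 0) \<longleftrightarrow> B + c = 1/4"
    \<comment> \<open>The coefficient of x is the case k = 0, with B + c in the role of c.\<close>
    using assms(1) coeff_eq_iff[of N "B + c" d 0 "1/4"] by (simp_all add: gbinomial_one_quarter)
  then have "maclaurin_coincide 3 (approx N A B C D E) (fourth_root N) \<longleftrightarrow>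
      A + B = 1 \<and> B + c = 1/4 \<and> c * d = 3/32 \<and> c * d\<^sup>2 = 7/128"
    unfolding maclaurin_coincide_def all_le_3 nths coeff_eq_iff[OF assms(1)]
    by (auto simp: gbinomial_one_quarter power2_eq_square)
  also have "\<dots> \<longleftrightarrow> A = 51/56 \<and> B = 5/56 \<and> c = 9/56 \<and> d = 7/12"
  proof
    assume "A + B = 1 \<and> B + c = 1/4 \<and> c * d = 3/32 \<and> c * d\<^sup>2 = 7/128"
    with coeff_match_unique[of c d] show "A = 51/56 \<and> B = 5/56 \<and> c = 9/56 \<and> d = 7/12"
      by simp
  next
    assume "A = 51/56 \<and> B = 5/56 \<and> c = 9/56 \<and> d = 7/12"
    then show "A + B = 1 \<and> B + c = 1/4 \<and> c * d = 3/32 \<and> c * d\<^sup>2 = 7/128"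
      by (elim conjE, hypsubst) (simp add: power2_eq_square)
  qed
  finally show ?thesis
    by (simp add: c_def d_def)
qed

text \<open>Multiplying out the factor 14 gives D = 14 * 7 = 98 and E = 14 * 5 = 70. Hence D + E =
  168, with ratios 27/168 = 9/56 and 98/168 = 7/12.\<close>

lemma S_approx_eq_approx: "S_approx N = approx N (51/56) (5/56) 27 98 70"
proof
  fix x
  have "98 * (N ^ 4 + x) + 70 * N ^ 4 = 14 * (7 * (N ^ 4 + x) + 5 * N ^ 4)"
    by simp
  then show "S_approx N x = approx N (51/56) (5/56) 27 98 70 x"
    unfolding S_approx_def approx_def Let_def by (simp only:)
qed

lemma S_approx_coincide_3:
  assumes "N > 0"
  shows "maclaurin_coincide 3 (S_approx N) (fourth_root N)"
  unfolding S_approx_eq_approx using assms by (subst coincide_3_iff_coeffs) simp_all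

text \<open>Coincidence fixes A, B and both ratios, hence the normal form and the whole function.
  Conversely, a Maclaurin series depends only on the values near 0.\<close>

lemma coincide_3_iff_equal_near_0:
  assumes "N > 0" "D + E \<noteq> 0"
  shows "maclaurin_coincide 3 (approx N A B C D E) (fourth_root N) \<longleftrightarrow>
    equal_near_0 (approx N A B C D E) (S_approx N)"
proof
  assume "maclaurin_coincide 3 (approx N A B C D E) (fourth_root N)"
  then have "A = 51/56" "B = 5/56" "C / (D + E) = 9/56" "D / (D + E) = 7/12"
    by (simp_all add: coincide_3_iff_coeffs[OF assms])
  moreover have "27 / (98 + 70) = (9/56 :: real)" "98 / (98 + 70) = (7/12 :: real)"
    "98 + 70 \<noteq> (0 :: real)"
    by simp_all
  ultimately have "approx N A B C D E = S_approx N"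
    unfolding S_approx_eq_approx by (simp only: fun_eq_iff approx_normal_form assms simp_thms)
  then show "equal_near_0 (approx N A B C D E) (S_approx N)"
    by (simp add: equal_near_0_def)
next
  assume "equal_near_0 (approx N A B C D E) (S_approx N)"
  then show "maclaurin_coincide 3 (approx N A B C D E) (fourth_root N)"
    using S_approx_coincide_3[OF assms(1)] by (simp add: maclaurin_coincide_def maclaurin_cong)
qed

lemma maclaurin_coincide_mono:
  assumes "maclaurin_coincide n f g" "m \<le> n"
  shows "maclaurin_coincide m f g"
  using assms by (simp add: maclaurin_coincide_def)

lemma not_coincide_4:
  assumes "N > 0" "D + E \<noteq> 0"
  shows "\<not> maclaurin_coincide 4 (approx N A B C D E) (fourth_root N)"
proof
  define c d where "c = C / (D + E)" and "d = D / (D + E)"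
  assume coincide: "maclaurin_coincide 4 (approx N A B C D E) (fourth_root N)"
  then have "maclaurin_coincide 3 (approx N A B C D E) (fourth_root N)"
    by (rule maclaurin_coincide_mono) simp
  then have cd: "c = 9/56" "d = 7/12"
    by (simp_all add: coincide_3_iff_coeffs[OF assms] c_def d_def)
  \<comment> \<open>The index 4 is written \<open>Suc (Suc 2)\<close> to fit the general coefficient
    formula with k = 2.\<close>
  have "fps_nth (maclaurin (approx N A B C D E)) (Suc (Suc 2)) =
      fps_nth (maclaurin (fourth_root N)) (Suc (Suc 2))"
    using coincide by (simp add: maclaurin_coincide_def)
  then have "c * (- d) ^ Suc 2 = ((1/4) gchoose Suc (Suc 2))"
    unfolding maclaurin_approx(3)[OF assms, of A B C, folded c_def d_def] maclaurin_fourth_root[OF assms(1)]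
      coeff_eq_iff[OF assms(1)] .
  \<comment> \<open>The left side equals -49/1536, the right side -77/2048.\<close>
  then show False
    by (simp add: cd gbinomial_one_quarter eval_nat_numeral)
qed

theorem mainTheorem3:
  fixes N :: real
  assumes "N > 0"
  shows
    "(\<forall>A B C D E. D + E \<noteq> 0 \<longrightarrow>
        (maclaurin_coincide 3 (approx N A B C D E) (fourth_root N)
           \<longleftrightarrow> equal_near_0 (approx N A B C D E) (S_approx N)))
     \<and> \<not> (\<exists>A B C D E. D + E \<noteq> 0 \<and>
            maclaurin_coincide 4 (approx N A B C D E) (fourth_root N))
     \<and> best_possible (approx_form N) (fourth_root N) (S_approx N)
     \<and> (\<forall>s. best_possible (approx_form N) (fourth_root N) s \<longrightarrow> equal_near_0 s (S_approx N))"
proof -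
  have S_form: "S_approx N \<in> approx_form N"
    unfolding approx_form_def S_approx_eq_approx by fastforce
  note S3 = S_approx_coincide_3[OF assms]
  \<comment> \<open>Since order 4 is out of reach, reaching order 3 suffices for being best
    possible.\<close>
  have le3: "n \<le> 3" if "t \<in> approx_form N" "maclaurin_coincide n t (fourth_root N)" for n t
  proof (rule ccontr)
    assume "\<not> n \<le> 3"
    then have "maclaurin_coincide 4 t (fourth_root N)"
      using that(2) by (auto intro: maclaurin_coincide_mono)
    then show False
      using that(1) not_coincide_4[OF assms] by (auto simp: approx_form_def)
  qed
  have "best_possible (approx_form N) (fourth_root N) (S_approx N)"
    using S_form S3 le3 by (auto simp: best_possible_def intro: maclaurin_coincide_mono)
  moreover have "equal_near_0 s (S_approx N)"
    if "best_possible (approx_form N) (fourth_root N) s" for s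
  proof -
    \<comment> \<open>A best possible \<open>s\<close> must match at least as far as
      \<open>S_approx N\<close> does, that is through x^3.\<close>
    have "s \<in> approx_form N" "maclaurin_coincide 3 s (fourth_root N)"
      using that S_form S3 by (auto simp: best_possible_def)
    then show ?thesis
      using coincide_3_iff_equal_near_0[OF assms] by (auto simp: approx_form_def)
  qed
  ultimately show ?thesis
    using coincide_3_iff_equal_near_0[OF assms] not_coincide_4[OF assms] by blast
qed

end
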